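(* Let $\mathfrak g$ be a metric Lie algebra with $Ann_R(\mathfrak g)=0$. Then there is an orthogonal direct sum decomposition $$\mathfrak g=\mathfrak g_1\oplus\cdots\oplus\mathfrak g_l$$ into non-zero, indecomposable, non-degenerate strong ideals, each with zero right annihilator. The factors $\mathfrak g_i$, as subspaces of $\mathfrak g$, are unique up to their order.
   Context: A metric Lie algebra is a finite-dimensional real Lie algebra $\mathfrak g$ with a non-degenerate symmetric bilinear form $\langle\cdot,\cdot\rangle$ (of arbitrary signature). Its Levi-Civita product $\nabla_XY$ is the bilinear product determined by $2\langle\nabla_XY,Z\rangle=\langle[X,Y],Z\rangle-\langle[Y,Z],X\rangle+\langle[Z,X],Y\rangle$. For subspaces, $\nabla_{\mathfrak a}\mathfrak b$ is the linear span of all $\nabla_XY$ with $X\in\mathfrak a$, $Y\in\mathfrak b$. The right annihilator is $Ann_R(\mathfrak g)=\{X\in\mathfrak g:\nabla_YX=0\ \forall Y\in\mathfrak g\}$. A subspace is non-degenerate if $\langle\cdot,\cdot\rangle$ restricts to a non-degenerate form on it. A subspace $\mathfrak h$ is a strong ideal if $\nabla_{\mathfrak g}\mathfrak h\subseteq\mathfrak h$ and $\nabla_{\mathfrak h}\mathfrak g\subseteq\mathfrak h$. A metric Lie algebra is decomposable if it is a direct sum of two non-zero, non-degenerate strong ideals, and indecomposable otherwise; a non-degenerate strong ideal is itself regarded as a metric Lie algebra with the restricted bracket and form (its Levi-Civita product is then the restriction of $\nabla$). Orthogonal means distinct summands are orthogonal for $\langle\cdot,\cdot\rangle$. *)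

theory Defs
  imports Complex_Main "HOL-Library.Multiset"
begin

text \<open>
  Lie algebras are carried by finite-dimensional subspaces \<open>g\<close> of a real vector space, so that a
  subspace of a metric Lie algebra can itself be regarded as one, with the same bracket \<open>br\<close> and
  form \<open>B\<close>. The values of \<open>br\<close> and \<open>B\<close> outside \<open>g\<close> are irrelevant.
\<close>

definition bilinear_on :: "'a::real_vector set \<Rightarrow> ('a \<Rightarrow> 'a \<Rightarrow> 'b::real_vector) \<Rightarrow> bool" where
  "bilinear_on g f \<longleftrightarrow>
     (\<forall>x\<in>g. \<forall>y\<in>g. \<forall>z\<in>g. f (x + y) z = f x z + f y z \<and> f z (x + y) = f z x + f z y) \<and>
     (\<forall>c. \<forall>x\<in>g. \<forall>y\<in>g. f (c *\<^sub>R x) y = c *\<^sub>R f x y \<and> f x (c *\<^sub>R y) = c *\<^sub>R f x y)"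

definition nondegenerate_on :: "'a::real_vector set \<Rightarrow> ('a \<Rightarrow> 'a \<Rightarrow> real) \<Rightarrow> bool" where
  "nondegenerate_on h B \<longleftrightarrow> (\<forall>x\<in>h. (\<forall>y\<in>h. B x y = 0) \<longrightarrow> x = 0)"

locale metric_lie_algebra =
  fixes g :: "'a::real_vector set"
    and br :: "'a \<Rightarrow> 'a \<Rightarrow> 'a"
    and B :: "'a \<Rightarrow> 'a \<Rightarrow> real"
  assumes subspace: "subspace g"
    and finite_dimensional: "\<exists>S. finite S \<and> g = span S"
    and bracket_closed: "x \<in> g \<Longrightarrow> y \<in> g \<Longrightarrow> br x y \<in> g"
    and bracket_bilinear: "bilinear_on g br"
    and bracket_alternating: "x \<in> g \<Longrightarrow> br x x = 0"
    and jacobi: "x \<in> g \<Longrightarrow> y \<in> g \<Longrightarrow> z \<in> g \<Longrightarrow>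
      br x (br y z) + br y (br z x) + br z (br x y) = 0"
    and form_bilinear: "bilinear_on g B"
    and form_symmetric: "x \<in> g \<Longrightarrow> y \<in> g \<Longrightarrow> B x y = B y x"
    and form_nondegenerate: "nondegenerate_on g B"

definition levi_civita ::
  "'a::real_vector set \<Rightarrow> ('a \<Rightarrow> 'a \<Rightarrow> 'a) \<Rightarrow> ('a \<Rightarrow> 'a \<Rightarrow> real) \<Rightarrow> 'a \<Rightarrow> 'a \<Rightarrow> 'a" where
  "levi_civita g br B x y =
     (THE w. w \<in> g \<and> (\<forall>z\<in>g. 2 * B w z = B (br x y) z - B (br y z) x + B (br z x) y))"

definition levi_civita_span ::
  "'a::real_vector set \<Rightarrow> ('a \<Rightarrow> 'a \<Rightarrow> 'a) \<Rightarrow> ('a \<Rightarrow> 'a \<Rightarrow> real) \<Rightarrow> 'a set \<Rightarrow> 'a set \<Rightarrow> 'a set" where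
  "levi_civita_span g br B a b = span {levi_civita g br B x y | x y. x \<in> a \<and> y \<in> b}"

definition right_annihilator ::
  "'a::real_vector set \<Rightarrow> ('a \<Rightarrow> 'a \<Rightarrow> 'a) \<Rightarrow> ('a \<Rightarrow> 'a \<Rightarrow> real) \<Rightarrow> 'a set" where
  "right_annihilator g br B = {x \<in> g. \<forall>y\<in>g. levi_civita g br B y x = 0}"

definition strong_ideal ::
  "'a::real_vector set \<Rightarrow> ('a \<Rightarrow> 'a \<Rightarrow> 'a) \<Rightarrow> ('a \<Rightarrow> 'a \<Rightarrow> real) \<Rightarrow> 'a set \<Rightarrow> bool" where
  "strong_ideal g br B h \<longleftrightarrow> subspace h \<and> h \<subseteq> g \<and>
     levi_civita_span g br B g h \<subseteq> h \<and> levi_civita_span g br B h g \<subseteq> h"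

text \<open>
  Internal direct sum of a list of subspaces; for the empty list it says \<open>g = {0}\<close>.
\<close>
definition direct_sum :: "'a::real_vector set \<Rightarrow> 'a set list \<Rightarrow> bool" where
  "direct_sum g hs \<longleftrightarrow> subspace g \<and> (\<forall>h\<in>set hs. subspace h \<and> h \<subseteq> g) \<and>
     (\<forall>x\<in>g. \<exists>!xs. list_all2 (\<in>) xs hs \<and> sum_list xs = x)"

definition orthogonal_summands :: "('a \<Rightarrow> 'a \<Rightarrow> real) \<Rightarrow> 'a set list \<Rightarrow> bool" where
  "orthogonal_summands B hs \<longleftrightarrow>
     (\<forall>i<length hs. \<forall>j<length hs. i \<noteq> j \<longrightarrow> (\<forall>x\<in>hs ! i. \<forall>y\<in>hs ! j. B x y = 0))"

definition decomposable ::
  "'a::real_vector set \<Rightarrow> ('a \<Rightarrow> 'a \<Rightarrow> 'a) \<Rightarrow> ('a \<Rightarrow> 'a \<Rightarrow> real) \<Rightarrow> bool" where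
  "decomposable g br B \<longleftrightarrow> (\<exists>a b. direct_sum g [a, b] \<and>
     (\<forall>h\<in>{a, b}. h \<noteq> {0} \<and> nondegenerate_on h B \<and> strong_ideal g br B h))"

abbreviation indecomposable ::
  "'a::real_vector set \<Rightarrow> ('a \<Rightarrow> 'a \<Rightarrow> 'a) \<Rightarrow> ('a \<Rightarrow> 'a \<Rightarrow> real) \<Rightarrow> bool" where
  "indecomposable g br B \<equiv> \<not> decomposable g br B"

text \<open>
  Indecomposability and the right annihilator of a summand \<open>h\<close> refer to \<open>h\<close> as a metric Lie
  algebra in its own right, hence to the Levi-Civita product computed in \<open>h\<close>.
\<close>
definition strong_decomposition ::
  "'a::real_vector set \<Rightarrow> ('a \<Rightarrow> 'a \<Rightarrow> 'a) \<Rightarrow> ('a \<Rightarrow> 'a \<Rightarrow> real) \<Rightarrow> 'a set list \<Rightarrow> bool" where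
  "strong_decomposition g br B hs \<longleftrightarrow> direct_sum g hs \<and> orthogonal_summands B hs \<and>
     (\<forall>h\<in>set hs. h \<noteq> {0} \<and> indecomposable h br B \<and> nondegenerate_on h B \<and>
        strong_ideal g br B h \<and> right_annihilator h br B = {0})"

lemma bilinear_on_sum_left:
  assumes "bilinear_on g f" "subspace g" "finite S" "\<And>i. i \<in> S \<Longrightarrow> v i \<in> g" "z \<in> g"
  shows "f (\<Sum>i\<in>S. c i *\<^sub>R v i) z = (\<Sum>i\<in>S. c i *\<^sub>R f (v i) z)"
  using assms(3,4)
proof (induction rule: finite_induct)
  case empty
  have "f (0 *\<^sub>R z) z = 0 *\<^sub>R f z z"
    using assms(1,5) unfolding bilinear_on_def by blast
  then show ?case by simp
next
  case (insert i S)
  have "(\<Sum>i\<in>S. c i *\<^sub>R v i) \<in> g" "c i *\<^sub>R v i \<in> g"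
    using insert assms(2) by (auto intro!: subspace_sum subspace_scale)
  then have "f (c i *\<^sub>R v i + (\<Sum>i\<in>S. c i *\<^sub>R v i)) z
      = f (c i *\<^sub>R v i) z + f (\<Sum>i\<in>S. c i *\<^sub>R v i) z"
    using assms(1,5) unfolding bilinear_on_def by blast
  moreover have "f (c i *\<^sub>R v i) z = c i *\<^sub>R f (v i) z"
    using assms(1,5) insert unfolding bilinear_on_def by blast
  ultimately show ?case using insert by simp
qed

context metric_lie_algebra
begin

text \<open>Every linear functional on \<open>g\<close> is represented by the form.\<close>
lemma riesz:
  assumes add: "\<And>x y. x \<in> g \<Longrightarrow> y \<in> g \<Longrightarrow> \<phi> (x + y) = \<phi> x + \<phi> y"
    and scale: "\<And>c x. x \<in> g \<Longrightarrow> \<phi> (c *\<^sub>R x) = c * \<phi> x"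
  shows "\<exists>!w. w \<in> g \<and> (\<forall>z\<in>g. B w z = \<phi> z)"
proof -
  obtain S0 where S0: "finite S0" "g = span S0" using finite_dimensional by (elim exE conjE)
  obtain S where S: "S \<subseteq> g" "independent S" "g \<subseteq> span S"
    by (rule basis_exists[of g])
  have gS: "g = span S" using S subspace by (simp add: span_minimal subset_antisym)
  have fin: "finite S" using independent_span_bound[OF S0(1) S(2)] S(1) S0(2) by blast
  have eq_on_basis: "\<psi> z = \<chi> z"
    if add1: "\<And>x y. x \<in> g \<Longrightarrow> y \<in> g \<Longrightarrow> \<psi> (x + y) = \<psi> x + \<psi> y"
      and scale1: "\<And>c x. x \<in> g \<Longrightarrow> \<psi> (c *\<^sub>R x) = c * \<psi> x"
      and add2: "\<And>x y. x \<in> g \<Longrightarrow> y \<in> g \<Longrightarrow> \<chi> (x + y) = \<chi> x + \<chi> y"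
      and scale2: "\<And>c x. x \<in> g \<Longrightarrow> \<chi> (c *\<^sub>R x) = c * \<chi> x"
      and S_eq: "\<And>b. b \<in> S \<Longrightarrow> \<psi> b = \<chi> b" and z: "z \<in> g"
    for \<psi> \<chi> :: "'a \<Rightarrow> real" and z
  proof -
    have "z \<in> span S" using z gS by simp
    then have "z \<in> g \<and> \<psi> z = \<chi> z"
    proof (induction rule: span_induct_alt)
      case base
      have "0 \<in> g" using subspace by (rule subspace_0)
      then show ?case using scale1[of 0 0] scale2[of 0 0] by simp
    next
      case (step c x y)
      then have x: "x \<in> g" "c *\<^sub>R x \<in> g" using S(1) subspace by (auto intro: subspace_scale)
      then have "c *\<^sub>R x + y \<in> g" using step subspace by (auto intro: subspace_add)
      then show ?case using x step add1 add2 scale1 scale2 S_eq by simp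
    qed
    then show ?thesis ..
  qed
  have Badd: "B w (x + y) = B w x + B w y" "B (x + y) w = B x w + B y w"
    and Bscale: "B w (c *\<^sub>R x) = c * B w x" "B (c *\<^sub>R x) w = c * B x w"
    if "w \<in> g" "x \<in> g" "y \<in> g" for w x y c
    using form_bilinear that unfolding bilinear_on_def by (blast, blast, force, force)
  define T where "T w = (\<Sum>b\<in>S. B w b *\<^sub>R b)" for w
  define U where "U u = (\<Sum>b\<in>S. u b *\<^sub>R b)" for u :: "'a \<Rightarrow> real"
  have Ug: "U u \<in> g" for u
    unfolding U_def using S(1) subspace by (auto intro!: subspace_sum subspace_scale)
  have TU: "T (U u) = (\<Sum>b\<in>S. u b *\<^sub>R T b)" for u
  proof -
    have "T (U u) = (\<Sum>b\<in>S. (\<Sum>a\<in>S. u a * B a b) *\<^sub>R b)"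
      unfolding T_def U_def using bilinear_on_sum_left[OF form_bilinear subspace fin, of "\<lambda>x. x"] S(1)
      by (intro sum.cong) auto
    also have "\<dots> = (\<Sum>b\<in>S. \<Sum>a\<in>S. u a *\<^sub>R (B a b *\<^sub>R b))"
      by (simp add: scaleR_sum_left)
    also have "\<dots> = (\<Sum>a\<in>S. \<Sum>b\<in>S. u a *\<^sub>R (B a b *\<^sub>R b))"
      by (rule sum.swap)
    finally show ?thesis by (simp add: T_def scaleR_sum_right)
  qed
  have coeff: "u b = v b" if "U u = U v" "b \<in> S" for u v b
  proof -
    have "(\<Sum>b\<in>S. (u b - v b) *\<^sub>R b) = 0"
      using that(1) by (simp add: U_def scaleR_left_diff_distrib sum_subtractf)
    then have "u b - v b = 0" by (rule independentD[OF S(2) fin subset_refl _ that(2)])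
    then show ?thesis by simp
  qed
  have T0: "w = 0" if "w \<in> g" "T w = 0" for w
  proof -
    have "U (B w) = U (\<lambda>_. 0)" using that(2) by (simp add: T_def U_def)
    note Bw = coeff[OF this]
    have "B w z = 0" if "z \<in> g" for z
      by (rule eq_on_basis[of "B w" "\<lambda>_. 0"])
        (simp_all add: Badd(1) Bscale(1)[OF _ _ \<open>w \<in> g\<close>] Bw \<open>w \<in> g\<close> that)
    then show ?thesis using form_nondegenerate \<open>w \<in> g\<close> unfolding nondegenerate_on_def by blast
  qed
  have U0: "u b = 0" if "(\<Sum>b\<in>S. u b *\<^sub>R T b) = 0" "b \<in> S" for u b
  proof -
    have "U u = U (\<lambda>_. 0)" using T0[OF Ug, of u] TU[of u] that(1) by (simp add: U_def)
    from coeff[OF this that(2)] show ?thesis .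
  qed
  have inj: "inj_on T S"
  proof (rule inj_onI, rule ccontr)
    fix a b assume ab: "a \<in> S" "b \<in> S" "T a = T b" "a \<noteq> b"
    let ?u = "\<lambda>c. if c = a then 1 else if c = b then -1 else (0::real)"
    have "(\<Sum>c\<in>S. ?u c *\<^sub>R T c) = (\<Sum>c\<in>{a, b}. ?u c *\<^sub>R T c)"
      using ab fin by (intro sum.mono_neutral_right) auto
    also have "\<dots> = 0" using ab by simp
    finally have "?u a = 0" using ab(1) by (rule U0)
    then show False by simp
  qed
  have ind: "independent (T ` S)"
  proof (rule independent_if_scalars_zero)
    show "finite (T ` S)" using fin by simp
    fix f x assume f: "(\<Sum>x\<in>T ` S. f x *\<^sub>R x) = 0" and "x \<in> T ` S"
    then obtain b where b: "b \<in> S" "x = T b" by blast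
    have "(\<Sum>b\<in>S. f (T b) *\<^sub>R T b) = 0" using f by (simp add: sum.reindex[OF inj])
    then show "f x = 0" using U0[of "\<lambda>b. f (T b)" b] b by simp
  qed
  have Tg: "T ` S \<subseteq> g"
    unfolding T_def using S(1) subspace by (auto intro!: subspace_sum subspace_scale)
  have "span (T ` S) = g"
  proof (rule ccontr)
    assume "span (T ` S) \<noteq> g"
    then obtain v where v: "v \<in> g" "v \<notin> span (T ` S)"
      using Tg subspace by (meson span_minimal subset_antisym subsetI)
    then have "independent (insert v (T ` S))" using ind by (simp add: independent_insertI)
    moreover have "insert v (T ` S) \<subseteq> span S" using v(1) Tg gS by simp
    ultimately have "card (insert v (T ` S)) \<le> card S"
      using independent_span_bound[OF fin] by blast
    moreover have "v \<notin> T ` S" using v(2) span_base by blast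
    ultimately show False using fin by (simp add: card_image[OF inj])
  qed
  then have "U \<phi> \<in> span (T ` S)" using Ug by simp
  then obtain f where "U \<phi> = (\<Sum>x\<in>T ` S. f x *\<^sub>R x)"
    using fin by (auto simp: span_finite)
  then have "U \<phi> = T (U (\<lambda>b. f (T b)))" by (simp add: TU sum.reindex[OF inj])
  moreover define w where "w = U (\<lambda>b. f (T b))"
  ultimately have w: "w \<in> g" "U \<phi> = U (B w)"
    by (simp_all only: Ug) (simp only: T_def U_def[of "B _"])
  have wz: "B w z = \<phi> z" if "z \<in> g" for z
    by (rule eq_on_basis[of "B w" \<phi>])
      (simp_all add: Badd(1) Bscale(1)[OF _ _ w(1)] add scale coeff[OF w(2)] w(1) that)
  moreover have "w' = w" if w': "w' \<in> g" "\<forall>z\<in>g. B w' z = \<phi> z" for w'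
  proof -
    have d: "w' - w \<in> g" "- w \<in> g"
      using w w' subspace by (auto intro: subspace_diff subspace_neg)
    have "B (w' - w) z = 0" if "z \<in> g" for z
      using Badd(2)[of z w' "- w"] Bscale(2)[of z w w "-1"] d that w w' wz by simp
    then show ?thesis using form_nondegenerate d unfolding nondegenerate_on_def by auto
  qed
  ultimately show ?thesis using w(1) by blast
qed

lemma levi_civita_ex1:
  assumes "x \<in> g" "y \<in> g"
  shows "\<exists>!w. w \<in> g \<and> (\<forall>z\<in>g. 2 * B w z = B (br x y) z - B (br y z) x + B (br z x) y)"
proof -
  let ?\<phi> = "\<lambda>z. (B (br x y) z - B (br y z) x + B (br z x) y) / 2"
  have "\<exists>!w. w \<in> g \<and> (\<forall>z\<in>g. B w z = ?\<phi> z)"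
  proof (rule riesz)
    fix u v assume "u \<in> g" "v \<in> g"
    then show "?\<phi> (u + v) = ?\<phi> u + ?\<phi> v"
      using form_bilinear bracket_bilinear assms bracket_closed
      by (simp add: bilinear_on_def add_divide_distrib diff_divide_distrib)
  next
    fix c u assume "u \<in> g"
    then show "?\<phi> (c *\<^sub>R u) = c * ?\<phi> u"
      using form_bilinear bracket_bilinear assms bracket_closed
      by (simp add: bilinear_on_def algebra_simps)
  qed
  moreover have "(2 * B w z = B (br x y) z - B (br y z) x + B (br z x) y) \<longleftrightarrow> B w z = ?\<phi> z" for w z
    by auto
  ultimately show ?thesis by simp
qed

lemma levi_civita:
  assumes "x \<in> g" "y \<in> g"
  shows levi_civita_closed: "levi_civita g br B x y \<in> g"
    and koszul: "z \<in> g \<Longrightarrow>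
      2 * B (levi_civita g br B x y) z = B (br x y) z - B (br y z) x + B (br z x) y"
  using theI'[OF levi_civita_ex1[OF assms]] unfolding levi_civita_def by auto

end

end

theory Submission
  imports Defs
begin

text \<open>
  If \<open>g\<close> is the direct sum of non-degenerate strong ideals \<open>a\<close> and \<open>b\<close>, then \<open>\<nabla>\<close> vanishes on mixed
  arguments, and the orthogonal projection to \<open>a\<close> of an element of \<open>b\<close> is annihilated by every
  \<open>\<nabla>\<^sub>Y\<close>. Hence \<open>Ann\<^sub>R(g) = 0\<close> forces \<open>a\<close> and \<open>b\<close> to be orthogonal, and splitting repeatedly gives
  existence. The same argument shows that the projection to a factor \<open>k\<close> maps every factor \<open>h\<close>
  into itself, so that \<open>h\<close> is the sum of its intersections with \<open>k\<close> and with the orthogonal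
  complement of \<open>k\<close>. An indecomposable \<open>h\<close> therefore lies in \<open>k\<close> or is orthogonal to \<open>k\<close>, which
  gives uniqueness.
\<close>

section \<open>Bilinear maps and subspaces of finite-dimensional spaces\<close>

lemma bilinear_on_simps:
  assumes "bilinear_on g f" "subspace g"
  shows bilinear_on_add_left: "\<lbrakk>x \<in> g; y \<in> g; z \<in> g\<rbrakk> \<Longrightarrow> f (x + y) z = f x z + f y z"
    and bilinear_on_add_right: "\<lbrakk>x \<in> g; y \<in> g; z \<in> g\<rbrakk> \<Longrightarrow> f z (x + y) = f z x + f z y"
    and bilinear_on_scale_left: "\<lbrakk>x \<in> g; z \<in> g\<rbrakk> \<Longrightarrow> f (c *\<^sub>R x) z = c *\<^sub>R f x z"
    and bilinear_on_scale_right: "\<lbrakk>x \<in> g; z \<in> g\<rbrakk> \<Longrightarrow> f z (c *\<^sub>R x) = c *\<^sub>R f z x"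
    and bilinear_on_diff_left: "\<lbrakk>x \<in> g; y \<in> g; z \<in> g\<rbrakk> \<Longrightarrow> f (x - y) z = f x z - f y z"
    and bilinear_on_diff_right: "\<lbrakk>x \<in> g; y \<in> g; z \<in> g\<rbrakk> \<Longrightarrow> f z (x - y) = f z x - f z y"
    and bilinear_on_zero_left: "z \<in> g \<Longrightarrow> f 0 z = 0"
    and bilinear_on_zero_right: "z \<in> g \<Longrightarrow> f z 0 = 0"
proof -
  show add_left: "f (x + y) z = f x z + f y z" if "x \<in> g" "y \<in> g" "z \<in> g" for x y z
    using assms(1) that unfolding bilinear_on_def by blast
  show add_right: "f z (x + y) = f z x + f z y" if "x \<in> g" "y \<in> g" "z \<in> g" for x y z
    using assms(1) that unfolding bilinear_on_def by blast
  show "f (c *\<^sub>R x) z = c *\<^sub>R f x z" if "x \<in> g" "z \<in> g" for x z c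
    using assms(1) that unfolding bilinear_on_def by blast
  show "f z (c *\<^sub>R x) = c *\<^sub>R f z x" if "x \<in> g" "z \<in> g" for x z c
    using assms(1) that unfolding bilinear_on_def by blast
  show "f (x - y) z = f x z - f y z" if "x \<in> g" "y \<in> g" "z \<in> g" for x y z
    using add_left[of "x - y" y z] that subspace_diff[OF assms(2)] by simp
  show "f z (x - y) = f z x - f z y" if "x \<in> g" "y \<in> g" "z \<in> g" for x y z
    using add_right[of "x - y" y z] that subspace_diff[OF assms(2)] by simp
  show "f 0 z = 0" if "z \<in> g" for z
    using add_left[of 0 0 z] that subspace_0[OF assms(2)] by simp
  show "f z 0 = 0" if "z \<in> g" for z
    using add_right[of 0 0 z] that subspace_0[OF assms(2)] by simp
qed

lemma bilinear_on_subset: "bilinear_on g f \<Longrightarrow> h \<subseteq> g \<Longrightarrow> bilinear_on h f"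
  unfolding bilinear_on_def by blast

text \<open>Termination measure for the existence proof: a basis of a proper subspace stays
  independent when a vector of the big space outside it is added, so it has strictly fewer elements
  than any finite spanning set of the big space.\<close>

lemma subspace_subset_span:
  assumes "subspace h" "h \<subseteq> span S" "finite S"
  obtains T where "finite T" "card T \<le> card S" "h = span T" "h \<noteq> span S \<Longrightarrow> card T < card S"
proof -
  obtain T where T: "T \<subseteq> h" "independent T" "h \<subseteq> span T" by (rule basis_exists[of h])
  have h: "h = span T" using T assms(1) by (simp add: span_minimal subset_antisym)
  have bound: "finite T" "card T \<le> card S"
    using independent_span_bound[OF assms(3) T(2)] T(1) assms(2) by auto
  have "card T < card S" if neq: "h \<noteq> span S"
  proof -
    obtain v where v: "v \<in> span S" "v \<notin> span T" using neq assms(2) h by blast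
    have "independent (insert v T)" using T(2) v(2) by (simp add: independent_insertI)
    then have "card (insert v T) \<le> card S"
      using independent_span_bound[OF assms(3)] v(1) T(1) assms(2) by blast
    moreover have "v \<notin> T" using v(2) span_base by blast
    ultimately show ?thesis using bound(1) by simp
  qed
  then show ?thesis using that bound h by blast
qed

section \<open>Direct sums given by lists of subspaces\<close>

lemma direct_sum_ex:
  assumes "direct_sum g hs" "x \<in> g"
  obtains xs where "list_all2 (\<in>) xs hs" "sum_list xs = x"
proof -
  have "\<exists>!xs. list_all2 (\<in>) xs hs \<and> sum_list xs = x"
    using assms unfolding direct_sum_def by simp
  then show ?thesis using that by (elim ex1E conjE)
qed

lemma direct_sum_unique:
  assumes "direct_sum g hs" "sum_list xs \<in> g"
    and "list_all2 (\<in>) xs hs" "list_all2 (\<in>) ys hs" "sum_list ys = sum_list xs"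
  shows "ys = xs"
proof -
  have "\<exists>!zs. list_all2 (\<in>) zs hs \<and> sum_list zs = sum_list xs"
    using assms(1,2) unfolding direct_sum_def by simp
  then show ?thesis using assms(3-5) by blast
qed

text \<open>Turns the list encoding into the usual criterion, sum and trivial intersection, in which
  the two-factor arguments below are carried out.\<close>

lemma direct_sum_pair_iff:
  "direct_sum g [a, b] \<longleftrightarrow> subspace g \<and> subspace a \<and> subspace b \<and> a \<subseteq> g \<and> b \<subseteq> g \<and>
     (\<forall>x\<in>g. \<exists>u\<in>a. \<exists>v\<in>b. x = u + v) \<and> a \<inter> b = {0}"
    (is "?L \<longleftrightarrow> ?R")
proof
  assume L: ?L
  then have sub: "subspace g" "subspace a" "subspace b" "a \<subseteq> g" "b \<subseteq> g"
    unfolding direct_sum_def by auto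
  have "\<exists>u\<in>a. \<exists>v\<in>b. x = u + v" if x: "x \<in> g" for x
  proof -
    obtain xs where "list_all2 (\<in>) xs [a, b]" "sum_list xs = x" using direct_sum_ex[OF L x] .
    then obtain u v where "u \<in> a" "v \<in> b" "x = u + v" by (auto simp: list_all2_Cons2)
    then show ?thesis by blast
  qed
  moreover have "x = 0" if "x \<in> a" "x \<in> b" for x
  proof -
    \<comment> \<open>A common element of \<open>a\<close> and \<open>b\<close> has two
      representations, which uniqueness identifies.\<close>
    have "list_all2 (\<in>) [x, 0] [a, b]" "list_all2 (\<in>) [0, x] [a, b]"
      using that sub subspace_0 by auto
    moreover have "x \<in> g" using that sub by blast
    ultimately have "[x, 0] = [0, x]" by (intro direct_sum_unique[OF L]) auto
    then show ?thesis by simp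
  qed
  ultimately show ?R using sub subspace_0 by blast
next
  assume R: ?R
  have "\<exists>!xs. list_all2 (\<in>) xs [a, b] \<and> sum_list xs = x" if x: "x \<in> g" for x
  proof -
    obtain u v where uv: "u \<in> a" "v \<in> b" "x = u + v" using R x by blast
    show ?thesis
    proof (rule ex1I[of _ "[u, v]"])
      show "list_all2 (\<in>) [u, v] [a, b] \<and> sum_list [u, v] = x" using uv by simp
    next
      fix xs assume "list_all2 (\<in>) xs [a, b] \<and> sum_list xs = x"
      then obtain u' v' where xs: "xs = [u', v']" "u' \<in> a" "v' \<in> b" "x = u' + v'"
        by (auto simp: list_all2_Cons2)
      then have "u' - u = v - v'" using uv by (simp add: algebra_simps)
      moreover have "u' - u \<in> a" "v - v' \<in> b" using R xs uv by (auto intro: subspace_diff)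
      ultimately have "u' - u \<in> a \<inter> b" "v - v' \<in> a \<inter> b" by auto
      then show "xs = [u, v]" using R xs by auto
    qed
  qed
  then show ?L unfolding direct_sum_def using R by auto
qed

lemma sum_list_mem_subspace:
  assumes "subspace P" "list_all2 (\<in>) xs hs" "\<And>h. h \<in> set hs \<Longrightarrow> h \<subseteq> P"
  shows "sum_list xs \<in> P"
  using assms(2,3)
proof (induction rule: list_all2_induct)
  case Nil
  then show ?case using assms(1) subspace_0 by simp
next
  case (Cons x xs h hs)
  then have "x \<in> P" "sum_list xs \<in> P" by auto
  then show ?case using assms(1) by (simp add: subspace_add)
qed

text \<open>Uniqueness is obtained in two stages: the partial sums over \<open>as\<close> and
  \<open>bs\<close> are the components in \<open>a\<close> and \<open>b\<close>, hence determined,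
  and each of them then determines its own list of entries.\<close>

lemma direct_sum_append:
  assumes ab: "direct_sum g [a, b]" and as: "direct_sum a as" and bs: "direct_sum b bs"
  shows "direct_sum g (as @ bs)"
proof -
  note g = ab[unfolded direct_sum_pair_iff]
  have ex1: "\<exists>!xs. list_all2 (\<in>) xs (as @ bs) \<and> sum_list xs = x" if "x \<in> g" for x
  proof -
    obtain u v where uv: "u \<in> a" "v \<in> b" "x = u + v" using g \<open>x \<in> g\<close> by blast
    obtain us where us: "list_all2 (\<in>) us as" "sum_list us = u"
      using direct_sum_ex[OF as uv(1)] .
    obtain vs where vs: "list_all2 (\<in>) vs bs" "sum_list vs = v"
      using direct_sum_ex[OF bs uv(2)] .
    show ?thesis
    proof (rule ex1I[of _ "us @ vs"])
      show "list_all2 (\<in>) (us @ vs) (as @ bs) \<and> sum_list (us @ vs) = x"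
        using us vs uv by (auto intro: list_all2_appendI)
    next
      fix xs assume xs: "list_all2 (\<in>) xs (as @ bs) \<and> sum_list xs = x"
      then obtain us' vs' where split: "xs = us' @ vs'"
          "list_all2 (\<in>) us' as" "list_all2 (\<in>) vs' bs"
        by (auto simp: list_all2_append2)
      have "sum_list us' \<in> a" "sum_list vs' \<in> b"
        using split as bs g by (auto intro!: sum_list_mem_subspace simp: direct_sum_def)
      then have "list_all2 (\<in>) [sum_list us', sum_list vs'] [a, b]" by simp
      moreover have "sum_list [sum_list us', sum_list vs'] = x" using xs split by simp
      moreover have "list_all2 (\<in>) [u, v] [a, b]" "sum_list [u, v] = x" using uv by auto
      ultimately have "[sum_list us', sum_list vs'] = [u, v]"
        using \<open>x \<in> g\<close> by (intro direct_sum_unique[OF ab]) simp_all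
      then have "us' = us" "vs' = vs"
        using direct_sum_unique[OF as, of us us'] direct_sum_unique[OF bs, of vs vs'] split us vs uv
        by simp_all
      then show "xs = us @ vs" using split by simp
    qed
  qed
  have "subspace h \<and> h \<subseteq> g" if "h \<in> set (as @ bs)" for h
  proof -
    have "h \<in> set as \<or> h \<in> set bs" using that by simp
    then have "subspace h \<and> (h \<subseteq> a \<or> h \<subseteq> b)" using as bs unfolding direct_sum_def by blast
    moreover have "a \<subseteq> g" "b \<subseteq> g" using g by simp_all
    ultimately show ?thesis by (meson subset_trans)
  qed
  moreover have "subspace g" using g by simp
  ultimately show ?thesis unfolding direct_sum_def using ex1 by simp
qed

lemma direct_sum_singleton: "subspace g \<Longrightarrow> direct_sum g [g]"
  unfolding direct_sum_def by (auto simp: list_all2_Cons2)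

section \<open>The Levi-Civita product: bilinear, metric and torsion-free\<close>

context metric_lie_algebra
begin

abbreviation nabla :: "'a \<Rightarrow> 'a \<Rightarrow> 'a" where
  "nabla \<equiv> levi_civita g br B"

lemmas form_simps = bilinear_on_simps[OF form_bilinear subspace]
lemmas bracket_simps = bilinear_on_simps[OF bracket_bilinear subspace]

lemma levi_civita_eqI:
  assumes "x \<in> g" "y \<in> g" "w \<in> g"
    and "\<And>z. z \<in> g \<Longrightarrow> 2 * B w z = B (br x y) z - B (br y z) x + B (br z x) y"
  shows "nabla x y = w"
  using levi_civita_ex1[OF assms(1,2)] levi_civita[OF assms(1,2)] assms(3,4) by blast

lemma levi_civita_bilinear: "bilinear_on g nabla"
proof -
  note closed = subspace_add[OF subspace] subspace_scale[OF subspace] levi_civita_closed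
    bracket_closed
  have "nabla (x + y) z = nabla x z + nabla y z" if "x \<in> g" "y \<in> g" "z \<in> g" for x y z
    by (rule levi_civita_eqI)
      (use that in \<open>simp_all add: closed form_simps bracket_simps koszul distrib_left\<close>)
  moreover have "nabla z (x + y) = nabla z x + nabla z y" if "x \<in> g" "y \<in> g" "z \<in> g" for x y z
    by (rule levi_civita_eqI)
      (use that in \<open>simp_all add: closed form_simps bracket_simps koszul distrib_left\<close>)
  moreover have "nabla (c *\<^sub>R x) z = c *\<^sub>R nabla x z" if "x \<in> g" "z \<in> g" for x z c
    by (rule levi_civita_eqI)
      (use that in \<open>simp_all add: closed form_simps bracket_simps koszul mult.left_commute algebra_simps\<close>)
  moreover have "nabla x (c *\<^sub>R z) = c *\<^sub>R nabla x z" if "x \<in> g" "z \<in> g" for x z c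
    by (rule levi_civita_eqI)
      (use that in \<open>simp_all add: closed form_simps bracket_simps koszul mult.left_commute algebra_simps\<close>)
  ultimately show ?thesis unfolding bilinear_on_def by blast
qed

lemmas nabla_simps = bilinear_on_simps[OF levi_civita_bilinear subspace]

lemma bracket_skew:
  assumes "x \<in> g" "y \<in> g"
  shows "br x y = - br y x"
proof -
  have xy: "x + y \<in> g" using assms subspace by (simp add: subspace_add)
  have "0 = br (x + y) (x + y)" using xy by (simp add: bracket_alternating)
  also have "\<dots> = br x (x + y) + br y (x + y)" using assms xy by (rule bracket_simps(1))
  also have "\<dots> = br x y + br y x" using assms by (simp add: bracket_simps(2) bracket_alternating)
  finally have "br x y + br y x = 0" by simp
  then show ?thesis by (simp add: add_eq_0_iff2)
qed

lemma form_minus_left: "x \<in> g \<Longrightarrow> y \<in> g \<Longrightarrow> B (- x) y = - B x y"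
  using form_simps(3)[of x y "-1"] by simp

text \<open>Exchanging \<open>y\<close> and \<open>z\<close> changes the sign of the right-hand side
  of the Koszul formula, because the bracket is skew.\<close>

lemma levi_civita_skew:
  assumes "x \<in> g" "y \<in> g" "z \<in> g"
  shows "B (nabla x y) z = - B y (nabla x z)"
proof -
  have "B y (nabla x z) = B (nabla x z) y" using assms by (simp add: form_symmetric levi_civita_closed)
  moreover have "B (br z y) x = - B (br y z) x" "B (br y x) z = - B (br x y) z"
      "B (br z x) y = - B (br x z) y"
    using assms bracket_skew[of z y] bracket_skew[of y x] bracket_skew[of z x]
    by (simp_all add: form_minus_left bracket_closed)
  ultimately show ?thesis using koszul[OF assms] koszul[OF assms(1,3,2)] by simp
qed

lemma form_eqI:
  assumes "x \<in> g" "y \<in> g" "\<And>z. z \<in> g \<Longrightarrow> B x z = B y z"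
  shows "x = y"
proof -
  have "x - y \<in> g" using assms subspace by (simp add: subspace_diff)
  moreover have "\<forall>z\<in>g. B (x - y) z = 0" using assms by (simp add: form_simps)
  ultimately have "x - y = 0" using form_nondegenerate unfolding nondegenerate_on_def by blast
  then show ?thesis by simp
qed

text \<open>In the difference of the Koszul formulas for \<open>nabla x y\<close> and
  \<open>nabla y x\<close> all terms cancel except \<open>2 * B (br x y) z\<close>.\<close>

lemma torsion_free:
  assumes "x \<in> g" "y \<in> g"
  shows "br x y = nabla x y - nabla y x"
proof (rule form_eqI)
  fix z assume z: "z \<in> g"
  have "B (br y x) z = - B (br x y) z" "B (br z y) x = - B (br y z) x"
      "B (br z x) y = - B (br x z) y"
    using assms z bracket_skew[of z y] bracket_skew[of y x] bracket_skew[of z x]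
    by (simp_all add: form_minus_left bracket_closed)
  then show "B (br x y) z = B (nabla x y - nabla y x) z"
    using koszul[OF assms z] koszul[OF assms(2,1) z] assms z
    by (simp add: form_simps levi_civita_closed)
qed (use assms in \<open>simp_all add: bracket_closed levi_civita_closed subspace_diff[OF subspace]\<close>)

section \<open>Strong ideals as metric Lie algebras\<close>

lemma strong_ideal_iff:
  "strong_ideal g br B h \<longleftrightarrow> subspace h \<and> h \<subseteq> g \<and>
     (\<forall>x\<in>g. \<forall>y\<in>h. nabla x y \<in> h \<and> nabla y x \<in> h)"
proof -
  have "levi_civita_span g br B a b \<subseteq> h \<longleftrightarrow> (\<forall>x\<in>a. \<forall>y\<in>b. nabla x y \<in> h)"
    if "subspace h" for a b
  proof
    show "\<forall>x\<in>a. \<forall>y\<in>b. nabla x y \<in> h" if "levi_civita_span g br B a b \<subseteq> h"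
      using that unfolding levi_civita_span_def by (blast intro: span_base)
    show "levi_civita_span g br B a b \<subseteq> h" if "\<forall>x\<in>a. \<forall>y\<in>b. nabla x y \<in> h"
      unfolding levi_civita_span_def using that \<open>subspace h\<close> by (intro span_minimal) auto
  qed
  then show ?thesis unfolding strong_ideal_def by blast
qed

text \<open>Strong ideals are defined through \<open>nabla\<close> alone; closure under the bracket
  comes from torsion-freeness, which writes the bracket as a difference of two products. Most other
  axioms restrict from \<open>g\<close> directly.\<close>

lemma metric_lie_algebra_strong_ideal:
  assumes "strong_ideal g br B h" "nondegenerate_on h B"
  shows "metric_lie_algebra h br B"
proof
  note h = assms(1)[unfolded strong_ideal_iff]
  show "subspace h" using h by blast
  obtain S where "finite S" "g = span S" using finite_dimensional by (elim exE conjE)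
  then show "\<exists>S. finite S \<and> h = span S" using h by (metis subspace_subset_span)
  show "br x y \<in> h" if "x \<in> h" "y \<in> h" for x y
  proof -
    have "br x y = nabla x y - nabla y x" using h that torsion_free by blast
    then show ?thesis using h that by (auto intro!: subspace_diff)
  qed
  show "bilinear_on h br" "bilinear_on h B"
    using h bracket_bilinear form_bilinear by (auto intro: bilinear_on_subset)
  show "br x x = 0" if "x \<in> h" for x using h that bracket_alternating by blast
  show "br x (br y z) + br y (br z x) + br z (br x y) = 0" if "x \<in> h" "y \<in> h" "z \<in> h" for x y z
    using h that jacobi by blast
  show "B x y = B y x" if "x \<in> h" "y \<in> h" for x y using h that form_symmetric by blast
  show "nondegenerate_on h B" by (fact assms(2))
qed

text \<open>The product taken in \<open>g\<close> stays in \<open>h\<close> and satisfies the Koszul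
  formula against all of \<open>h\<close>, so it is the unique solution there.\<close>

lemma levi_civita_strong_ideal:
  assumes "strong_ideal g br B h" "nondegenerate_on h B" "x \<in> h" "y \<in> h"
  shows "levi_civita h br B x y = nabla x y"
proof -
  interpret h: metric_lie_algebra h br B using assms by (blast intro: metric_lie_algebra_strong_ideal)
  have h: "h \<subseteq> g" "nabla x y \<in> h" "x \<in> g" "y \<in> g"
    using assms unfolding strong_ideal_iff by auto
  show ?thesis
    by (rule h.levi_civita_eqI) (use assms(3,4) h koszul[OF h(3,4)] in auto)
qed

section \<open>Orthogonal complements and projections\<close>

definition perp :: "'a set \<Rightarrow> 'a set" where
  "perp h = {x \<in> g. \<forall>y\<in>h. B x y = 0}"

lemma subspace_perp: "h \<subseteq> g \<Longrightarrow> subspace (perp h)"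
  unfolding perp_def
  by (rule subspaceI)
    (auto simp: form_simps subset_iff subspace_0[OF subspace] subspace_add[OF subspace]
      subspace_scale[OF subspace])

lemma perp_disjoint: "nondegenerate_on h B \<Longrightarrow> x \<in> h \<Longrightarrow> x \<in> perp h \<Longrightarrow> x = 0"
  unfolding nondegenerate_on_def perp_def by auto

text \<open>A skew operator preserves the complement of every subspace it preserves. This is one
  half of the strong ideal property of \<open>perp h\<close>; the half with the element of
  \<open>perp h\<close> as left argument is demanded in \<open>orthogonal_factor\<close>.\<close>

lemma nabla_perp:
  assumes "strong_ideal g br B h" "x \<in> perp h" "y \<in> g"
  shows "nabla y x \<in> perp h"
proof -
  have "B (nabla y x) z = 0" if "z \<in> h" for z
    using assms that levi_civita_skew[of y x z] unfolding perp_def strong_ideal_iff by auto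
  then show ?thesis using assms unfolding perp_def by (simp add: levi_civita_closed)
qed

text \<open>The projection is the vector of \<open>h\<close> that represents the functional
  \<open>B x\<close> on \<open>h\<close>; the representation result is applied inside
  \<open>h\<close>, whose form is non-degenerate.\<close>

lemma orthogonal_projection:
  assumes "strong_ideal g br B h" "nondegenerate_on h B" "x \<in> g"
  obtains p where "p \<in> h" "x - p \<in> perp h"
proof -
  interpret h: metric_lie_algebra h br B using assms by (blast intro: metric_lie_algebra_strong_ideal)
  have hg: "h \<subseteq> g" using assms unfolding strong_ideal_iff by blast
  obtain p where p: "p \<in> h" "\<forall>z\<in>h. B p z = B x z"
    using h.riesz[of "B x"] hg assms(3) by (auto simp: form_simps subset_iff)
  have "x - p \<in> perp h"
    using p hg assms(3) unfolding perp_def by (auto simp: form_simps subset_iff subspace_diff[OF subspace])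
  with p(1) show ?thesis by (rule that)
qed

text \<open>Since \<open>nabla y p = - nabla y (x - p)\<close>, this vector lies both in
  \<open>h\<close> and in \<open>perp h\<close>. In effect \<open>nabla y\<close> commutes with the
  projection to \<open>h\<close>.\<close>

lemma nabla_projection_zero:
  assumes "strong_ideal g br B h" "nondegenerate_on h B"
    and "p \<in> h" "x - p \<in> perp h" "x \<in> g" "y \<in> g" "nabla y x = 0"
  shows "nabla y p = 0"
proof (rule perp_disjoint[OF assms(2)])
  have hg: "h \<subseteq> g" "p \<in> g" using assms(1,3) unfolding strong_ideal_iff by auto
  show "nabla y p \<in> h" using assms(1,3,6) unfolding strong_ideal_iff by blast
  have "nabla y (x - p) \<in> perp h" using nabla_perp[OF assms(1,4,6)] .
  then have "- nabla y (x - p) \<in> perp h" using subspace_perp[OF hg(1)] by (simp add: subspace_neg)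
  then show "nabla y p \<in> perp h" using assms(5-7) hg(2) by (simp add: nabla_simps)
qed

section \<open>Strong ideals whose orthogonal complement is a strong ideal\<close>

definition orthogonal_factor :: "'a set \<Rightarrow> bool" where
  "orthogonal_factor h \<longleftrightarrow>
     nondegenerate_on h B \<and> strong_ideal g br B h \<and> strong_ideal g br B (perp h)"

lemma orthogonal_factorD:
  assumes "orthogonal_factor h"
  shows "nondegenerate_on h B" "strong_ideal g br B h" "strong_ideal g br B (perp h)"
    "subspace h" "h \<subseteq> g" "subspace (perp h)" "perp h \<subseteq> g"
  using assms unfolding orthogonal_factor_def strong_ideal_iff by auto

lemma orthogonal_factor_split:
  assumes "orthogonal_factor h" "x \<in> g"
  obtains u v where "u \<in> h" "v \<in> perp h" "x = u + v"
proof -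
  obtain p where "p \<in> h" "x - p \<in> perp h"
    using orthogonal_projection[OF orthogonal_factorD(2,1)[OF assms(1)] assms(2)] .
  then show ?thesis using that[of p "x - p"] by simp
qed

text \<open>Each mixed product lies in both strong ideals \<open>h\<close> and
  \<open>perp h\<close>, which meet only in zero.\<close>

lemma orthogonal_factor_mixed:
  assumes "orthogonal_factor h" "x \<in> h" "y \<in> perp h"
  shows "nabla x y = 0" "nabla y x = 0"
proof -
  have "x \<in> g" "y \<in> g" using assms(2,3) orthogonal_factorD(5,7)[OF assms(1)] by auto
  then have "nabla x y \<in> h" "nabla x y \<in> perp h" "nabla y x \<in> h" "nabla y x \<in> perp h"
    using assms(2,3) orthogonal_factorD(2,3)[OF assms(1)] unfolding strong_ideal_iff by auto
  then show "nabla x y = 0" "nabla y x = 0"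
    using perp_disjoint orthogonal_factorD(1)[OF assms(1)] by auto
qed

text \<open>An element of \<open>g\<close> acts on \<open>k\<close> inside \<open>h\<close> only
  through its \<open>h\<close>-component, since mixed products vanish. This moves splittings of a
  factor back and forth between \<open>h\<close> and \<open>g\<close>.\<close>

lemma strong_ideal_orthogonal_factor:
  assumes h: "orthogonal_factor h"
  shows "strong_ideal h br B k \<longleftrightarrow> strong_ideal g br B k \<and> k \<subseteq> h"
proof -
  interpret h: metric_lie_algebra h br B
    using orthogonal_factorD[OF h] by (blast intro: metric_lie_algebra_strong_ideal)
  note lc = levi_civita_strong_ideal[OF orthogonal_factorD(2,1)[OF h]]
  note hg = orthogonal_factorD(5,7)[OF h]
  have "nabla x y \<in> k \<and> nabla y x \<in> k"
    if k: "subspace k" "k \<subseteq> h" "\<forall>x\<in>h. \<forall>y\<in>k. nabla x y \<in> k \<and> nabla y x \<in> k"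
      and xy: "x \<in> g" "y \<in> k" for x y
  proof -
    obtain u v where uv: "u \<in> h" "v \<in> perp h" "x = u + v"
      using orthogonal_factor_split[OF h xy(1)] .
    then have "nabla x y = nabla u y" "nabla y x = nabla y u"
      using orthogonal_factor_mixed[OF h] k(2) xy(2) hg
      by (auto simp: nabla_simps subset_iff)
    then show ?thesis using k(3) uv(1) xy(2) by simp
  qed
  moreover have "levi_civita h br B x y = nabla x y \<and> levi_civita h br B y x = nabla y x"
    if "k \<subseteq> h" "x \<in> h" "y \<in> k" for x y
    using lc that by blast
  ultimately show ?thesis unfolding strong_ideal_iff h.strong_ideal_iff using hg
    by (smt (verit, best) subsetD subset_trans)
qed

text \<open>Again only the \<open>h\<close>-component of \<open>y\<close> contributes to
  \<open>nabla y x\<close> for \<open>x\<close> in \<open>h\<close>, so what is annihilated by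
  \<open>h\<close> is annihilated by \<open>g\<close>.\<close>

lemma right_annihilator_orthogonal_factor:
  assumes h: "orthogonal_factor h" and ann: "right_annihilator g br B = {0}"
  shows "right_annihilator h br B = {0}"
proof -
  interpret h: metric_lie_algebra h br B
    using orthogonal_factorD[OF h] by (blast intro: metric_lie_algebra_strong_ideal)
  note lc = levi_civita_strong_ideal[OF orthogonal_factorD(2,1)[OF h]]
  note hg = orthogonal_factorD(5,7)[OF h]
  have "x = 0" if x: "x \<in> h" "\<forall>y\<in>h. levi_civita h br B y x = 0" for x
  proof -
    have "nabla y x = 0" if y: "y \<in> g" for y
    proof -
      obtain u v where uv: "u \<in> h" "v \<in> perp h" "y = u + v"
        using orthogonal_factor_split[OF h y] .
      then have "nabla y x = nabla u x"
        using orthogonal_factor_mixed[OF h] x(1) hg by (auto simp: nabla_simps subset_iff)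
      then show ?thesis using x uv(1) lc by simp
    qed
    then have "x \<in> right_annihilator g br B" using x(1) hg unfolding right_annihilator_def by blast
    then show ?thesis using ann by blast
  qed
  then show ?thesis
    unfolding right_annihilator_def
    using subspace_0[OF h.subspace] bilinear_on_zero_right[OF h.levi_civita_bilinear h.subspace]
    by auto
qed

section \<open>Consequences of a zero right annihilator\<close>

text \<open>Let \<open>p\<close> be the projection to \<open>a\<close> of an element
  \<open>x\<close> of \<open>b\<close>. Elements of \<open>b\<close> kill \<open>p\<close> because
  the product is mixed; elements of \<open>a\<close> kill \<open>x\<close> for the same reason, and
  hence also its projection \<open>p\<close>. So \<open>p\<close> is in the right annihilator and
  vanishes.\<close>

lemma direct_sum_strong_ideals_perp:
  assumes ann: "right_annihilator g br B = {0}" and ab: "direct_sum g [a, b]"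
    and a: "nondegenerate_on a B" "strong_ideal g br B a" and b: "strong_ideal g br B b"
  shows "b = perp a"
proof -
  note ds = ab[unfolded direct_sum_pair_iff]
  note mem = a(2)[unfolded strong_ideal_iff] b[unfolded strong_ideal_iff]
  have ba: "x \<in> perp a" if x: "x \<in> b" for x
  proof -
    have xg: "x \<in> g" using x ds by blast
    obtain p where p: "p \<in> a" "x - p \<in> perp a" using orthogonal_projection[OF a(2,1) xg] .
    have pg: "p \<in> g" using p ds by blast
    have "nabla y p = 0" if "y \<in> g" for y
    proof -
      obtain u v where uv: "u \<in> a" "v \<in> b" "y = u + v" using ds \<open>y \<in> g\<close> by blast
      then have uvg: "u \<in> g" "v \<in> g" using ds by auto
      have "nabla v p \<in> a \<inter> b" using mem p(1) pg uv(2) uvg by auto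
      then have "nabla v p = 0" using ds by blast
      moreover have "nabla u x \<in> a \<inter> b" using mem x xg uv(1) uvg by auto
      then have "nabla u x = 0" using ds by blast
      then have "nabla u p = 0" using nabla_projection_zero[OF a(2,1) p xg] uvg(1) by blast
      ultimately show ?thesis using uv(3) uvg pg by (simp add: nabla_simps)
    qed
    then have "p \<in> right_annihilator g br B" using pg unfolding right_annihilator_def by blast
    then show ?thesis using ann p by simp
  qed
  \<comment> \<open>For the reverse inclusion, the \<open>a\<close>-component of \<open>x\<close> is
    the difference of two elements of \<open>perp a\<close>, so it lies in \<open>a\<close> and in
    \<open>perp a\<close>.\<close>
  have "x \<in> b" if x: "x \<in> perp a" for x
  proof -
    have "x \<in> g" using x unfolding perp_def by blast
    then obtain u v where uv: "u \<in> a" "v \<in> b" "x = u + v" using ds by blast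
    then have "x - v \<in> perp a" using x ba[OF uv(2)] subspace_perp[of a] ds by (blast intro: subspace_diff)
    then have "u = 0" using uv perp_disjoint[OF a(1), of u] by simp
    then show ?thesis using uv by simp
  qed
  then show ?thesis using ba by blast
qed

text \<open>The part \<open>v\<close> of \<open>p\<close> outside \<open>h\<close> is shown to be in
  the right annihilator, testing separately with the components \<open>s\<close> in \<open>h\<close>
  and \<open>t\<close> in \<open>perp h\<close> of an arbitrary \<open>y\<close>.\<close>

lemma projection_orthogonal_factor:
  assumes ann: "right_annihilator g br B = {0}"
    and h: "orthogonal_factor h" and k: "orthogonal_factor k"
    and x: "x \<in> h" and p: "p \<in> k" "x - p \<in> perp k"
  shows "p \<in> h"
proof -
  note hD = orthogonal_factorD[OF h] and kD = orthogonal_factorD[OF k]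
  have xg: "x \<in> g" and pg: "p \<in> g" using hD kD x p by auto
  obtain u v where uv: "u \<in> h" "v \<in> perp h" "p = u + v"
    using orthogonal_factor_split[OF h pg] .
  have uvg: "u \<in> g" "v \<in> g" using uv hD by auto
  have "nabla y v = 0" if y: "y \<in> g" for y
  proof -
    obtain s t where st: "s \<in> h" "t \<in> perp h" "y = s + t"
      using orthogonal_factor_split[OF h y] .
    have stg: "s \<in> g" "t \<in> g" using st hD by auto
    \<comment> \<open>As a mixed product for \<open>h\<close>, \<open>nabla t x\<close> vanishes;
      vanishing passes to the projection \<open>p\<close> to \<open>k\<close>, and then to
      \<open>v\<close>, since \<open>t\<close> also kills \<open>u\<close>. On the other side
      \<open>nabla s v\<close> is itself mixed.\<close>
    have "nabla t x = 0" using orthogonal_factor_mixed[OF h x st(2)] by blast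
    then have "nabla t p = 0" using nabla_projection_zero[OF kD(2,1) p xg stg(2)] by blast
    then have "nabla t v = 0"
      using uv(3) uvg stg orthogonal_factor_mixed[OF h uv(1) st(2)] by (simp add: nabla_simps)
    then show ?thesis
      using st stg uvg orthogonal_factor_mixed[OF h st(1) uv(2)] by (simp add: nabla_simps)
  qed
  then have "v \<in> right_annihilator g br B" using uvg unfolding right_annihilator_def by blast
  then show ?thesis using ann uv by simp
qed

text \<open>Projecting to \<open>k\<close> keeps elements of \<open>h\<close> in \<open>h\<close>,
  so \<open>h\<close> is the sum of \<open>h \<inter> k\<close> and
  \<open>h \<inter> perp k\<close>. If neither inclusion held, both pieces would be non-zero and
  would decompose \<open>h\<close>.\<close>

lemma indecomposable_factor_dichotomy:
  assumes ann: "right_annihilator g br B = {0}"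
    and h: "orthogonal_factor h" and k: "orthogonal_factor k" and ind: "indecomposable h br B"
  shows "h \<subseteq> k \<or> h \<subseteq> perp k"
proof (rule ccontr)
  assume not: "\<not> (h \<subseteq> k \<or> h \<subseteq> perp k)"
  note hD = orthogonal_factorD[OF h] and kD = orthogonal_factorD[OF k]
  let ?a = "h \<inter> k" and ?b = "h \<inter> perp k"
  have split: "\<exists>u\<in>?a. \<exists>v\<in>?b. x = u + v" if x: "x \<in> h" for x
  proof -
    have "x \<in> g" using hD(5) x by blast
    then obtain p where p: "p \<in> k" "x - p \<in> perp k" using orthogonal_projection[OF kD(2,1)] by blast
    have "p \<in> h" using projection_orthogonal_factor[OF ann h k x p] .
    then have "x - p \<in> h" using x hD(4) by (simp add: subspace_diff)
    with p \<open>p \<in> h\<close> show ?thesis by (intro bexI[of _ p] bexI[of _ "x - p"]) auto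
  qed
  have zero: "0 \<in> ?a" "0 \<in> ?b" using hD(4) kD(4,6) by (auto simp: subspace_0)
  have disj: "?a \<inter> ?b = {0}" using zero perp_disjoint[OF kD(1)] by blast
  have ds: "direct_sum h [?a, ?b]"
    unfolding direct_sum_pair_iff using hD(4) kD(4,6) split disj
    by (intro conjI ballI subspace_inter) auto
  have orth: "B u v = 0" "B v u = 0" if "u \<in> ?a" "v \<in> ?b" for u v
    using that hD(5) form_symmetric[of u v] unfolding perp_def by auto
  \<comment> \<open>A vector of one piece is orthogonal to the other piece anyway; if it is also
    orthogonal to its own, it is orthogonal to all of \<open>h\<close>.\<close>
  have nondeg: "nondegenerate_on ?a B" "nondegenerate_on ?b B"
  proof -
    have "nondegenerate_on c B" if c: "c = ?a \<or> c = ?b" for c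
      unfolding nondegenerate_on_def
    proof (intro ballI impI)
      fix x assume x: "x \<in> c" and xc: "\<forall>y\<in>c. B x y = 0"
      have xh: "x \<in> h" using x c by blast
      have "B x y = 0" if y: "y \<in> h" for y
      proof -
        obtain u v where uv: "u \<in> ?a" "v \<in> ?b" "y = u + v" using split[OF y] by blast
        then have "B x u = 0" "B x v = 0" using x c xc orth by blast+
        moreover have "x \<in> g" "u \<in> g" "v \<in> g" using xh uv hD by auto
        ultimately show ?thesis using uv(3) by (simp add: form_simps)
      qed
      then show "x = 0" using xh hD(1) unfolding nondegenerate_on_def by blast
    qed
    then show "nondegenerate_on ?a B" "nondegenerate_on ?b B" by simp_all
  qed
  have "strong_ideal g br B ?a" "strong_ideal g br B ?b"
    using hD(2) kD(2,3) unfolding strong_ideal_iff by (auto intro: subspace_inter)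
  then have "strong_ideal h br B ?a" "strong_ideal h br B ?b"
    using strong_ideal_orthogonal_factor[OF h] by auto
  moreover have "?a \<noteq> {0}"
  proof
    assume "?a = {0}"
    then have "h \<subseteq> perp k" using split by fastforce
    with not show False by blast
  qed
  moreover have "?b \<noteq> {0}"
  proof
    assume "?b = {0}"
    then have "h \<subseteq> k" using split by fastforce
    with not show False by blast
  qed
  ultimately have "decomposable h br B" using ds nondeg unfolding decomposable_def by blast
  with ind show False by blast
qed

section \<open>Uniqueness of the decomposition\<close>

text \<open>The complement of \<open>h\<close> is the sum of the remaining factors, so it inherits
  from them the missing half of the strong ideal property.\<close>

lemma strong_decomposition_orthogonal_factor:
  assumes sd: "strong_decomposition g br B hs" and h: "h \<in> set hs"
  shows "orthogonal_factor h"
proof -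
  have ds: "direct_sum g hs" and orth: "orthogonal_summands B hs"
    and fac: "\<And>k. k \<in> set hs \<Longrightarrow> nondegenerate_on k B \<and> strong_ideal g br B k"
    using sd unfolding strong_decomposition_def by auto
  have hn: "nondegenerate_on h B" and hs: "strong_ideal g br B h" using fac[OF h] by auto
  have hg: "subspace h" "h \<subseteq> g" using hs unfolding strong_ideal_iff by auto
  obtain us vs where split: "hs = us @ h # vs" using split_list[OF h] by blast
  \<comment> \<open>\<open>P\<close> collects the vectors of \<open>perp h\<close> that already have
    the missing half. It is a subspace containing every other factor, hence all sums of their
    elements.\<close>
  define P where "P = {x \<in> perp h. \<forall>y\<in>g. nabla x y \<in> perp h}"
  have P: "subspace P"
    using subspace_perp[OF hg(2)] unfolding subspace_def[of P] P_def
    by (auto simp: perp_def nabla_simps form_simps subspace_0[OF subspace] subspace_def[of "{x. _ x}"])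
  have sub: "k \<subseteq> P" if k: "k \<in> set us \<union> set vs" for k
  proof -
    have "\<exists>i<length hs. i \<noteq> length us \<and> hs ! i = k"
    proof (cases "k \<in> set us")
      case True
      then obtain i where "i < length us" "us ! i = k" by (auto simp: in_set_conv_nth)
      then show ?thesis using split by (intro exI[of _ i]) (auto simp: nth_append)
    next
      case False
      then obtain i where "i < length vs" "vs ! i = k" using k by (auto simp: in_set_conv_nth)
      then show ?thesis using split by (intro exI[of _ "length us + Suc i"]) (auto simp: nth_append)
    qed
    then obtain i where "i < length hs" "i \<noteq> length us" "hs ! i = k" by blast
    moreover have "length us < length hs" "hs ! length us = h" using split by auto
    ultimately have kh: "\<forall>x\<in>k. \<forall>y\<in>h. B x y = 0" using orth unfolding orthogonal_summands_def by metis
    have ks: "strong_ideal g br B k" using fac k split by auto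
    then have "k \<subseteq> perp h" using kh unfolding perp_def strong_ideal_iff by auto
    then show ?thesis using ks unfolding P_def strong_ideal_iff by blast
  qed
  have "x \<in> P" if x: "x \<in> perp h" for x
  proof -
    have "x \<in> g" using x unfolding perp_def by blast
    then obtain xs where xs: "list_all2 (\<in>) xs hs" "sum_list xs = x"
      using direct_sum_ex[OF ds] by blast
    then obtain ss t ts where parts: "xs = ss @ t # ts" "list_all2 (\<in>) ss us" "t \<in> h"
        "list_all2 (\<in>) ts vs"
      unfolding split by (auto simp: list_all2_append2 list_all2_Cons2)
    have "sum_list ss \<in> P" "sum_list ts \<in> P"
      using parts sub by (auto intro!: sum_list_mem_subspace[OF P])
    then have r: "sum_list ss + sum_list ts \<in> P" using P by (simp add: subspace_add)
    \<comment> \<open>The \<open>h\<close>-component \<open>t\<close> of \<open>x\<close> also lies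
      in \<open>perp h\<close>, so it vanishes and \<open>x\<close> is a sum over the other
      factors.\<close>
    have "t = x - (sum_list ss + sum_list ts)" using xs(2) parts(1) by (simp add: algebra_simps)
    also have "\<dots> \<in> perp h"
      using x r subspace_perp[OF hg(2)] unfolding P_def by (blast intro: subspace_diff)
    finally have "t = 0" using perp_disjoint[OF hn parts(3)] by blast
    then show ?thesis using r xs(2) parts(1) by simp
  qed
  then have "strong_ideal g br B (perp h)"
    using subspace_perp[OF hg(2)] nabla_perp[OF hs] unfolding strong_ideal_iff P_def
    by (auto simp: perp_def[of h])
  then show ?thesis using hn hs unfolding orthogonal_factor_def by blast
qed

text \<open>The subspace \<open>perp {x}\<close> contains every factor, hence all of
  \<open>g\<close>, and the form on \<open>g\<close> is non-degenerate.\<close>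

lemma strong_decomposition_perp:
  assumes sd: "strong_decomposition g br B hs" and x: "x \<in> g" "\<And>k. k \<in> set hs \<Longrightarrow> x \<in> perp k"
  shows "x = 0"
proof -
  have ds: "direct_sum g hs" using sd unfolding strong_decomposition_def by blast
  define P where "P = perp {x}"
  have P: "subspace P" unfolding P_def using x by (intro subspace_perp) auto
  have sub: "k \<subseteq> P" if k: "k \<in> set hs" for k
    using x(2)[OF k] ds k x(1) form_symmetric[of x] unfolding P_def perp_def direct_sum_def
    by fastforce
  have "B x y = 0" if y: "y \<in> g" for y
  proof -
    obtain xs where "list_all2 (\<in>) xs hs" "sum_list xs = y"
      using direct_sum_ex[OF ds y] .
    then have "y \<in> P" using sum_list_mem_subspace[OF P _ sub] by blast
    then show ?thesis using x(1) y form_symmetric unfolding P_def perp_def by auto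
  qed
  then show ?thesis using form_nondegenerate x(1) unfolding nondegenerate_on_def by blast
qed

text \<open>If \<open>h\<close> were in no factor of \<open>gs\<close>, the dichotomy would make it
  orthogonal to all of them, hence zero.\<close>

lemma strong_decomposition_refine:
  assumes ann: "right_annihilator g br B = {0}"
    and gs: "strong_decomposition g br B gs" and hs: "strong_decomposition g br B hs"
    and h: "h \<in> set hs"
  obtains k where "k \<in> set gs" "h \<subseteq> k"
proof -
  have hf: "orthogonal_factor h" using strong_decomposition_orthogonal_factor[OF hs h] .
  have hi: "h \<noteq> {0}" "indecomposable h br B" using hs h unfolding strong_decomposition_def by auto
  have "\<exists>k\<in>set gs. h \<subseteq> k"
  proof (rule ccontr)
    assume none: "\<not> ?thesis"
    have "h \<subseteq> perp k" if k: "k \<in> set gs" for k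
      using indecomposable_factor_dichotomy[OF ann hf _ hi(2)]
        strong_decomposition_orthogonal_factor[OF gs k] none k by blast
    then have "x = 0" if "x \<in> h" for x
      using strong_decomposition_perp[OF gs, of x] that orthogonal_factorD(5)[OF hf] by blast
    then show False using hi(1) subspace_0[OF orthogonal_factorD(4)[OF hf]] by blast
  qed
  then show ?thesis using that by blast
qed

text \<open>At distinct positions the smaller factor would be orthogonal to itself, which is
  impossible for a non-zero non-degenerate space. Positions rather than subspaces are compared so
  that distinctness of the list follows as well.\<close>

lemma strong_decomposition_nested_eq:
  assumes sd: "strong_decomposition g br B hs"
    and ij: "i < length hs" "j < length hs" "hs ! i \<subseteq> hs ! j"
  shows "i = j"
proof (rule ccontr)
  assume "i \<noteq> j"
  then have "\<forall>x\<in>hs ! i. \<forall>y\<in>hs ! j. B x y = 0"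
    using sd ij unfolding strong_decomposition_def orthogonal_summands_def by blast
  moreover have "hs ! i \<noteq> {0}" "nondegenerate_on (hs ! i) B" "strong_ideal g br B (hs ! i)"
    using sd ij unfolding strong_decomposition_def by auto
  moreover have "\<forall>x\<in>hs ! i. \<forall>y\<in>hs ! i. B x y = 0" using calculation(1) ij(3) by blast
  moreover have "0 \<in> hs ! i" using calculation(4) subspace_0 unfolding strong_ideal_iff by blast
  ultimately show False unfolding nondegenerate_on_def by blast
qed

text \<open>Refining in both directions gives a chain from \<open>h\<close> through a factor
  \<open>k\<close> of \<open>gs\<close> to a factor \<open>h'\<close> of \<open>hs\<close>; nested
  factors of \<open>hs\<close> coincide, so all three are equal.\<close>

lemma strong_decomposition_subset:
  assumes ann: "right_annihilator g br B = {0}"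
    and gs: "strong_decomposition g br B gs" and hs: "strong_decomposition g br B hs"
  shows "set hs \<subseteq> set gs"
proof
  fix h assume h: "h \<in> set hs"
  obtain k where k: "k \<in> set gs" "h \<subseteq> k" using strong_decomposition_refine[OF ann gs hs h] .
  obtain h' where h': "h' \<in> set hs" "k \<subseteq> h'" using strong_decomposition_refine[OF ann hs gs k(1)] .
  have "h \<subseteq> h'" using k h' by blast
  then have "h = h'" using strong_decomposition_nested_eq[OF hs] h h'(1) by (metis in_set_conv_nth)
  then show "h \<in> set gs" using k h' by auto
qed

lemma strong_decomposition_distinct: "strong_decomposition g br B hs \<Longrightarrow> distinct hs"
  using strong_decomposition_nested_eq by (metis distinct_conv_nth order_refl)

lemma strong_decomposition_unique:
  assumes "right_annihilator g br B = {0}"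
    and "strong_decomposition g br B gs" "strong_decomposition g br B hs"
  shows "mset hs = mset gs"
  using strong_decomposition_subset[OF assms] strong_decomposition_subset[OF assms(1,3,2)]
    strong_decomposition_distinct assms(2,3) set_eq_iff_mset_eq_distinct by blast

section \<open>Existence of the decomposition\<close>

text \<open>Factors from different lists are orthogonal because \<open>b = perp a\<close>, and
  strong ideals of \<open>a\<close> or \<open>b\<close> are strong ideals of \<open>g\<close>.
  Indecomposability and the right annihilator refer to the factor alone and carry over
  unchanged.\<close>

lemma strong_decomposition_append:
  assumes ann: "right_annihilator g br B = {0}"
    and a: "orthogonal_factor a" and b: "orthogonal_factor b" "b = perp a"
    and ds: "direct_sum g [a, b]"
    and as: "strong_decomposition a br B as" and bs: "strong_decomposition b br B bs"
  shows "strong_decomposition g br B (as @ bs)"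
proof -
  note ad = as[unfolded strong_decomposition_def] and bd = bs[unfolded strong_decomposition_def]
  have "direct_sum g (as @ bs)" using direct_sum_append[OF ds] ad bd by blast
  moreover have "orthogonal_summands B (as @ bs)"
    unfolding orthogonal_summands_def
  proof (intro allI impI ballI)
    fix i j x y
    assume ij: "i < length (as @ bs)" "j < length (as @ bs)" "i \<noteq> j"
      and x: "x \<in> (as @ bs) ! i" and y: "y \<in> (as @ bs) ! j"
    have oa: "\<forall>i<length as. \<forall>j<length as. i \<noteq> j \<longrightarrow> (\<forall>x\<in>as ! i. \<forall>y\<in>as ! j. B x y = 0)"
      and ob: "\<forall>i<length bs. \<forall>j<length bs. i \<noteq> j \<longrightarrow> (\<forall>x\<in>bs ! i. \<forall>y\<in>bs ! j. B x y = 0)"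
      using ad bd unfolding orthogonal_summands_def by auto
    have ina: "as ! i \<subseteq> a" if "i < length as" for i
      using ad that unfolding direct_sum_def by auto
    have inb: "bs ! i \<subseteq> b" if "i < length bs" for i
      using bd that unfolding direct_sum_def by auto
    have ba: "B v u = 0" "B u v = 0" if "u \<in> a" "v \<in> b" for u v
      using that b(2) orthogonal_factorD(5)[OF a] form_symmetric[of u v] unfolding perp_def by auto
    consider "i < length as" "j < length as" | "i < length as" "\<not> j < length as"
      | "\<not> i < length as" "j < length as" | "\<not> i < length as" "\<not> j < length as" by blast
    then show "B x y = 0"
    proof cases
      case 1
      then show ?thesis using x y oa ij(3) by (auto simp: nth_append)
    next
      case 2
      then have "j - length as < length bs" using ij by auto
      then have "x \<in> a" "y \<in> b"
        using 2 x y ina[of i] inb[of "j - length as"] by (auto simp: nth_append)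
      then show ?thesis by (rule ba)
    next
      case 3
      then have "i - length as < length bs" using ij by auto
      then have "y \<in> a" "x \<in> b"
        using 3 x y ina[of j] inb[of "i - length as"] by (auto simp: nth_append)
      then show ?thesis by (rule ba)
    next
      case 4
      then have "i - length as < length bs" "j - length as < length bs"
          "i - length as \<noteq> j - length as" using ij by auto
      then show ?thesis using x y ob 4 by (auto simp: nth_append)
    qed
  qed
  moreover have "h \<noteq> {0} \<and> indecomposable h br B \<and> nondegenerate_on h B \<and>
        strong_ideal g br B h \<and> right_annihilator h br B = {0}" if "h \<in> set (as @ bs)" for h
    using that ad bd strong_ideal_orthogonal_factor[OF a] strong_ideal_orthogonal_factor[OF b(1)]
    by auto
  ultimately show ?thesis unfolding strong_decomposition_def by blast
qed

end

lemma strong_decomposition_exists: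
  assumes "finite S" "g = span S"
    and "metric_lie_algebra g br B" "right_annihilator g br B = {0}"
  shows "\<exists>gs. strong_decomposition g br B gs"
  using assms
proof (induction "card S" arbitrary: S g rule: less_induct)
  case less
  interpret metric_lie_algebra g br B by (fact less.prems(3))
  note ann = less.prems(4)
  \<comment> \<open>The zero algebra needs its own case: factors are non-zero, so its decomposition
    is the empty list.\<close>
  consider "g = {0}" | "g \<noteq> {0}" "indecomposable g br B" | "decomposable g br B" by blast
  then show ?case
  proof cases
    case 1
    then have "strong_decomposition g br B []"
      unfolding strong_decomposition_def direct_sum_def orthogonal_summands_def
      by auto
    then show ?thesis ..
  next
    case 2
    have "strong_ideal g br B g" unfolding strong_ideal_iff using subspace levi_civita_closed by auto
    then have "strong_decomposition g br B [g]"
      unfolding strong_decomposition_def orthogonal_summands_def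
      using 2 direct_sum_singleton[OF subspace] form_nondegenerate ann by auto
    then show ?thesis ..
  next
    case 3
    then obtain a b where ds: "direct_sum g [a, b]" and ab0: "a \<noteq> {0}" "b \<noteq> {0}"
      and n: "nondegenerate_on a B" "nondegenerate_on b B"
      and s: "strong_ideal g br B a" "strong_ideal g br B b"
      unfolding decomposable_def by auto
    note d = ds[unfolded direct_sum_pair_iff]
    have ds': "direct_sum g [b, a]"
      unfolding direct_sum_pair_iff using d by (metis Int_commute add.commute)
    \<comment> \<open>Each summand is the complement of the other, so both complements are strong
      ideals and both summands are orthogonal factors.\<close>
    have pb: "b = perp a" using direct_sum_strong_ideals_perp[OF ann ds n(1) s] .
    have pa: "a = perp b" using direct_sum_strong_ideals_perp[OF ann ds' n(2) s(2,1)] .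
    have fa: "orthogonal_factor a" and fb: "orthogonal_factor b"
      unfolding orthogonal_factor_def pa[symmetric] pb[symmetric] by (simp_all only: n s)
    \<comment> \<open>If one summand were all of \<open>g\<close>, it would contain the other, which
      would then be zero. Properness makes the spanning sets shrink.\<close>
    have ne: "a \<noteq> g" "b \<noteq> g" using d ab0 by blast+
    have IH: "\<exists>hs. strong_decomposition c br B hs" if c: "orthogonal_factor c" "c \<noteq> g" for c
    proof -
      note cD = orthogonal_factorD[OF c(1)]
      obtain T where T: "finite T" "c = span T" "card T < card S"
        using subspace_subset_span[of c S] cD(4,5) less.prems(1,2) c(2) by blast
      show ?thesis
        using less.hyps[OF T(3,1,2)] metric_lie_algebra_strong_ideal[OF cD(2,1)]
          right_annihilator_orthogonal_factor[OF c(1) ann] by blast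
    qed
    obtain as bs where "strong_decomposition a br B as" "strong_decomposition b br B bs"
      using IH[OF fa ne(1)] IH[OF fb ne(2)] by blast
    then show ?thesis using strong_decomposition_append[OF ann fa fb pb ds] by blast
  qed
qed

theorem theorem3p12:
  fixes g :: "'a::real_vector set"
    and br :: "'a \<Rightarrow> 'a \<Rightarrow> 'a"
    and B :: "'a \<Rightarrow> 'a \<Rightarrow> real"
  assumes "metric_lie_algebra g br B"
    and "right_annihilator g br B = {0}"
  shows "\<exists>gs. strong_decomposition g br B gs \<and>
           (\<forall>hs. strong_decomposition g br B hs \<longrightarrow> mset hs = mset gs)"
proof -
  interpret metric_lie_algebra g br B by (fact assms(1))
  obtain S where "finite S" "g = span S" using finite_dimensional by (elim exE conjE)
  then obtain gs where "strong_decomposition g br B gs"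
    using strong_decomposition_exists assms by blast
  then show ?thesis using strong_decomposition_unique[OF assms(2)] by blast
qed

end
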